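(* Let $K$ be a field and $E$ a row-finite graph, let $v_0\in E^0$ be a vertex, and let $n$ be a positive integer. Then $L_K(E(v_0,n))\cong L_K(E'(v_0,n))$ as $K$-algebras.
   Context: A (directed) graph $E=(E^0,E^1,s,r)$ consists of two disjoint sets $E^0$ (vertices) and $E^1$ (edges) and maps $s,r:E^1\to E^0$ (source and range). It is row-finite if $|s^{-1}(v)|<\infty$ for all $v\in E^0$. A vertex $v$ is regular if $0<|s^{-1}(v)|<\infty$. For a vertex $v_0\in E^0$ and a positive integer $n$, the graphs $E(v_0,n)$ and $E'(v_0,n)$ both have vertices $E^0\cup\{v_1,\dots,v_n\}$ and edges $E^1\cup\{e_1,\dots,e_n\}$ (all $v_i,e_i$ with $i\ge 1$ being new), with source and range maps extending those of $E$ and with $s(e_i)=v_i$ for $1\le i\le n$. In $E(v_0,n)$ one has $r(e_i)=v_{i-1}$ for $1\le i\le n$, while in $E'(v_0,n)$ one has $r(e_i)=v_0$ for $1\le i\le n$. For a field $K$, the Leavitt path algebra $L_K(E)$ is the (associative, not necessarily unital if $E^0$ is infinite) $K$-algebra generated by $\{v,e,e^*\mid v\in E^0,e\in E^1\}$ subject to, for all $v,w\in E^0$, $e,f\in E^1$: (1) $vw=\delta_{v,w}w$; (2) $s(e)e=e=e\,r(e)$ and $r(e)e^*=e^*=e^*s(e)$; (3) $e^*f=\delta_{e,f}r(e)$; (4) $v=\sum_{e\in s^{-1}(v)}ee^*$ for every regular vertex $v$. *)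

theory Defs
  imports "HOL-Library.Poly_Mapping" "Graph_Theory.Digraph"
begin

section \<open>Algebras without unit over a field\<close>

record ('k, 'a) alg =
  carrier :: "'a set"
  add :: "'a \<Rightarrow> 'a \<Rightarrow> 'a"
  mul :: "'a \<Rightarrow> 'a \<Rightarrow> 'a"
  scale :: "'k \<Rightarrow> 'a \<Rightarrow> 'a"

definition alg_iso :: "('k, 'a) alg \<Rightarrow> ('k, 'b) alg \<Rightarrow> ('a \<Rightarrow> 'b) \<Rightarrow> bool" where
  "alg_iso A B h \<longleftrightarrow>
     bij_betw h (carrier A) (carrier B) \<and>
     (\<forall>x\<in>carrier A. \<forall>y\<in>carrier A. h (add A x y) = add B (h x) (h y)) \<and>
     (\<forall>x\<in>carrier A. \<forall>y\<in>carrier A. h (mul A x y) = mul B (h x) (h y)) \<and>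
     (\<forall>c. \<forall>x\<in>carrier A. h (scale A c x) = scale B c (h x))"

definition alg_isomorphic :: "('k, 'a) alg \<Rightarrow> ('k, 'b) alg \<Rightarrow> bool" (infix "\<cong>\<^sub>a" 50) where
  "A \<cong>\<^sub>a B \<longleftrightarrow> (\<exists>h. alg_iso A B h)"


section \<open>Algebras given by generators and relations\<close>

text \<open>
  The free monoid is written additively: this makes \<open>'x fword \<Rightarrow>\<^sub>0 'k\<close>, with the
  convolution product of finitely supported functions, the free associative unital algebra.
\<close>

datatype 'x fword = FWord (letters: "'x list")

instantiation fword :: (type) monoid_add
begin

definition zero_fword :: "'a fword" where
  "0 = FWord []"

definition plus_fword :: "'a fword \<Rightarrow> 'a fword \<Rightarrow> 'a fword" where
  "u + v = FWord (letters u @ letters v)"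

instance
  by standard (simp_all add: zero_fword_def plus_fword_def)

end

text \<open>
  The free algebra without unit on the set \<open>X\<close>: linear combinations of nonempty words over \<open>X\<close>.
\<close>

definition free_alg :: "'x set \<Rightarrow> ('x fword \<Rightarrow>\<^sub>0 'k::field) set" where
  "free_alg X = {p. \<forall>w\<in>Poly_Mapping.keys p. letters w \<noteq> [] \<and> set (letters w) \<subseteq> X}"

definition gen :: "'x \<Rightarrow> ('x fword \<Rightarrow>\<^sub>0 'k::field)" where
  "gen x = Poly_Mapping.single (FWord [x]) 1"

definition free_scale :: "'k \<Rightarrow> ('x fword \<Rightarrow>\<^sub>0 'k::field) \<Rightarrow> ('x fword \<Rightarrow>\<^sub>0 'k)" where
  "free_scale c p = Poly_Mapping.map ((*) c) p"

inductive_set gen_ideal :: "'x set \<Rightarrow> ('x fword \<Rightarrow>\<^sub>0 'k::field) set \<Rightarrow> ('x fword \<Rightarrow>\<^sub>0 'k) set"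
  for X R where
  zero: "0 \<in> gen_ideal X R"
| base: "p \<in> R \<Longrightarrow> p \<in> gen_ideal X R"
| add: "p \<in> gen_ideal X R \<Longrightarrow> q \<in> gen_ideal X R \<Longrightarrow> p + q \<in> gen_ideal X R"
| scale: "p \<in> gen_ideal X R \<Longrightarrow> free_scale c p \<in> gen_ideal X R"
| left: "a \<in> free_alg X \<Longrightarrow> p \<in> gen_ideal X R \<Longrightarrow> a * p \<in> gen_ideal X R"
| right: "a \<in> free_alg X \<Longrightarrow> p \<in> gen_ideal X R \<Longrightarrow> p * a \<in> gen_ideal X R"

definition pres_rel ::
  "'x set \<Rightarrow> ('x fword \<Rightarrow>\<^sub>0 'k::field) set \<Rightarrow> (('x fword \<Rightarrow>\<^sub>0 'k) \<times> ('x fword \<Rightarrow>\<^sub>0 'k)) set" where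
  "pres_rel X R = {(p, q). p \<in> free_alg X \<and> q \<in> free_alg X \<and> p - q \<in> gen_ideal X R}"

definition presented_alg ::
  "'x set \<Rightarrow> ('x fword \<Rightarrow>\<^sub>0 'k::field) set \<Rightarrow> ('k, ('x fword \<Rightarrow>\<^sub>0 'k) set) alg" where
  "presented_alg X R = \<lparr>
     carrier = free_alg X // pres_rel X R,
     add = (\<lambda>A B. \<Union>p\<in>A. \<Union>q\<in>B. pres_rel X R `` {p + q}),
     mul = (\<lambda>A B. \<Union>p\<in>A. \<Union>q\<in>B. pres_rel X R `` {p * q}),
     scale = (\<lambda>c A. \<Union>p\<in>A. pres_rel X R `` {free_scale c p}) \<rparr>"


subsection \<open>The operations are well defined on classes\<close>

lemma free_scale_conv_mult: "free_scale c p = Poly_Mapping.single 0 c * p"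
  by (simp add: free_scale_def mult_map_scale_conv_mult)

lemma free_scale_diff: "free_scale c p - free_scale c q = free_scale c (p - q)"
  by (simp add: free_scale_conv_mult right_diff_distrib)

lemma free_alg_add: "p \<in> free_alg X \<Longrightarrow> q \<in> free_alg X \<Longrightarrow> p + q \<in> free_alg X"
  using Poly_Mapping.keys_add[of p q] by (auto simp: free_alg_def)

lemma free_alg_mult: "p \<in> free_alg X \<Longrightarrow> q \<in> free_alg X \<Longrightarrow> p * q \<in> free_alg X"
  using Poly_Mapping.keys_mult[of p q] by (fastforce simp: free_alg_def plus_fword_def)

lemma free_alg_scale: "p \<in> free_alg X \<Longrightarrow> free_scale c p \<in> free_alg X"
  by (auto simp: free_alg_def free_scale_def Poly_Mapping.in_keys_iff Poly_Mapping.map.rep_eq when_def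
      split: if_splits)

lemma gen_ideal_minus: "p \<in> gen_ideal X R \<Longrightarrow> - p \<in> gen_ideal X R"
proof -
  have "free_scale (- 1) p = - p"
    by (simp add: free_scale_conv_mult single_uminus)
  then show "p \<in> gen_ideal X R \<Longrightarrow> - p \<in> gen_ideal X R"
    using gen_ideal.scale[of p X R "- 1"] by simp
qed

lemma equiv_pres_rel: "equiv (free_alg X) (pres_rel X R)"
proof (rule equivI)
  show "pres_rel X R \<subseteq> free_alg X \<times> free_alg X"
    by (auto simp: pres_rel_def)
  show "refl_on (free_alg X) (pres_rel X R)"
    by (auto simp: refl_on_def pres_rel_def gen_ideal.zero)
  show "sym (pres_rel X R)"
    by (rule symI) (auto simp: pres_rel_def dest: gen_ideal_minus)
  show "trans (pres_rel X R)"
    by (rule transI) (auto simp: pres_rel_def dest: gen_ideal.add)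
qed

lemma pres_rel_add:
  assumes "(p, p') \<in> pres_rel X R" "(q, q') \<in> pres_rel X R"
  shows "(p + q, p' + q') \<in> pres_rel X R"
proof -
  have "p + q - (p' + q') = (p - p') + (q - q')" by simp
  moreover have "(p - p') + (q - q') \<in> gen_ideal X R"
    using assms by (intro gen_ideal.add) (auto simp: pres_rel_def)
  ultimately have "p + q - (p' + q') \<in> gen_ideal X R" by (simp only:)
  then show ?thesis
    using assms by (simp add: pres_rel_def free_alg_add)
qed

lemma pres_rel_mult:
  assumes "(p, p') \<in> pres_rel X R" "(q, q') \<in> pres_rel X R"
  shows "(p * q, p' * q') \<in> pres_rel X R"
proof -
  have "p * q - p' * q' = (p - p') * q + p' * (q - q')" by (simp add: algebra_simps)
  then show ?thesis
    using assms unfolding pres_rel_def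
    by (auto intro: free_alg_mult gen_ideal.add gen_ideal.left gen_ideal.right)
qed

lemma pres_rel_scale:
  assumes "(p, p') \<in> pres_rel X R"
  shows "(free_scale c p, free_scale c p') \<in> pres_rel X R"
  using assms unfolding pres_rel_def
  by (auto intro: free_alg_scale gen_ideal.scale simp: free_scale_diff)

lemma presented_alg_add:
  assumes "p \<in> free_alg X" "q \<in> free_alg X"
  shows "add (presented_alg X R) (pres_rel X R `` {p}) (pres_rel X R `` {q}) = pres_rel X R `` {p + q}"
  unfolding presented_alg_def alg.simps
  by (rule UN_equiv_class2[OF equiv_pres_rel equiv_pres_rel _ assms], rule congruent2I')
    (auto intro!: equiv_class_eq[OF equiv_pres_rel] pres_rel_add)

lemma presented_alg_mul:
  assumes "p \<in> free_alg X" "q \<in> free_alg X"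
  shows "mul (presented_alg X R) (pres_rel X R `` {p}) (pres_rel X R `` {q}) = pres_rel X R `` {p * q}"
  unfolding presented_alg_def alg.simps
  by (rule UN_equiv_class2[OF equiv_pres_rel equiv_pres_rel _ assms], rule congruent2I')
    (auto intro!: equiv_class_eq[OF equiv_pres_rel] pres_rel_mult)

lemma presented_alg_scale:
  assumes "p \<in> free_alg X"
  shows "scale (presented_alg X R) c (pres_rel X R `` {p}) = pres_rel X R `` {free_scale c p}"
  unfolding presented_alg_def alg.simps
  by (rule UN_equiv_class[OF equiv_pres_rel _ assms], rule congruentI)
    (auto intro!: equiv_class_eq[OF equiv_pres_rel] pres_rel_scale)


section \<open>Leavitt path algebras\<close>

definition row_finite :: "('v, 'e) pre_digraph \<Rightarrow> bool" where
  "row_finite E \<longleftrightarrow> (\<forall>v\<in>verts E. finite (out_arcs E v))"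

definition regular_vertex :: "('v, 'e) pre_digraph \<Rightarrow> 'v \<Rightarrow> bool" where
  "regular_vertex E v \<longleftrightarrow> v \<in> verts E \<and> finite (out_arcs E v) \<and> out_arcs E v \<noteq> {}"

datatype ('v, 'e) lpa_gen = Vertex 'v | Edge 'e | Ghost 'e

definition lpa_gens :: "('v, 'e) pre_digraph \<Rightarrow> ('v, 'e) lpa_gen set" where
  "lpa_gens E = Vertex ` verts E \<union> Edge ` arcs E \<union> Ghost ` arcs E"

inductive_set lpa_relators :: "('v, 'e) pre_digraph \<Rightarrow> (('v, 'e) lpa_gen fword \<Rightarrow>\<^sub>0 'k::field) set"
  for E where
  vertices: "v \<in> verts E \<Longrightarrow> w \<in> verts E \<Longrightarrow>
    gen (Vertex v) * gen (Vertex w) - (if v = w then gen (Vertex w) else 0) \<in> lpa_relators E"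
| edge_source: "e \<in> arcs E \<Longrightarrow>
    gen (Vertex (tail E e)) * gen (Edge e) - gen (Edge e) \<in> lpa_relators E"
| edge_range: "e \<in> arcs E \<Longrightarrow>
    gen (Edge e) * gen (Vertex (head E e)) - gen (Edge e) \<in> lpa_relators E"
| ghost_range: "e \<in> arcs E \<Longrightarrow>
    gen (Vertex (head E e)) * gen (Ghost e) - gen (Ghost e) \<in> lpa_relators E"
| ghost_source: "e \<in> arcs E \<Longrightarrow>
    gen (Ghost e) * gen (Vertex (tail E e)) - gen (Ghost e) \<in> lpa_relators E"
| CK1: "e \<in> arcs E \<Longrightarrow> f \<in> arcs E \<Longrightarrow>
    gen (Ghost e) * gen (Edge f) - (if e = f then gen (Vertex (head E e)) else 0) \<in> lpa_relators E"
| CK2: "regular_vertex E v \<Longrightarrow>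
    gen (Vertex v) - (\<Sum>e\<in>out_arcs E v. gen (Edge e) * gen (Ghost e)) \<in> lpa_relators E"

lemma lpa_relators_subset:
  assumes "wf_digraph E"
  shows "lpa_relators E \<subseteq> free_alg (lpa_gens E)"
proof
  interpret wf_digraph E by fact
  have diff: "p - q \<in> free_alg X" if "p \<in> free_alg X" "q \<in> free_alg X"
    for p q :: "'x fword \<Rightarrow>\<^sub>0 'k::field" and X
    using that Poly_Mapping.keys_diff[of p q] by (auto simp: free_alg_def)
  have gen: "gen x \<in> free_alg X" if "x \<in> X" for x :: 'x and X
    using that by (simp add: free_alg_def gen_def)
  have zero: "0 \<in> free_alg X" for X
    by (simp add: free_alg_def)
  have sum: "(\<Sum>i\<in>I. f i) \<in> free_alg X" if "\<And>i. i \<in> I \<Longrightarrow> f i \<in> free_alg X"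
    for f :: "'i \<Rightarrow> 'x fword \<Rightarrow>\<^sub>0 'k::field" and I X
    using that by (induction I rule: infinite_finite_induct) (auto intro: zero free_alg_add)
  fix p
  assume "p \<in> lpa_relators E"
  then show "p \<in> free_alg (lpa_gens E)"
    by cases (auto intro!: diff gen zero sum free_alg_mult simp: lpa_gens_def regular_vertex_def)
qed

text \<open>The first argument only serves to name the field.\<close>

definition leavitt_path_algebra ::
  "'k::field itself \<Rightarrow> ('v, 'e) pre_digraph \<Rightarrow> ('k, (('v, 'e) lpa_gen fword \<Rightarrow>\<^sub>0 'k) set) alg" where
  "leavitt_path_algebra K E = presented_alg (lpa_gens E) (lpa_relators E)"


section \<open>The graphs $E(v_0,n)$ (chain) and $E'(v_0,n)$ (star)\<close>

text \<open>
  The new vertices \<open>v\<^sub>i\<close> and edges \<open>e\<^sub>i\<close>, for \<open>1 \<le> i \<le> n\<close>, are both represented by \<open>Inr i\<close>.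
\<close>

definition chain_vertex :: "'v \<Rightarrow> nat \<Rightarrow> 'v + nat" where
  "chain_vertex v\<^sub>0 i = (if i = 0 then Inl v\<^sub>0 else Inr i)"

definition chain_graph :: "('v, 'e) pre_digraph \<Rightarrow> 'v \<Rightarrow> nat \<Rightarrow> ('v + nat, 'e + nat) pre_digraph" where
  "chain_graph E v\<^sub>0 n = \<lparr>
     verts = Inl ` verts E \<union> Inr ` {1..n},
     arcs = Inl ` arcs E \<union> Inr ` {1..n},
     tail = (\<lambda>a. case a of Inl e \<Rightarrow> Inl (tail E e) | Inr i \<Rightarrow> chain_vertex v\<^sub>0 i),
     head = (\<lambda>a. case a of Inl e \<Rightarrow> Inl (head E e) | Inr i \<Rightarrow> chain_vertex v\<^sub>0 (i - 1)) \<rparr>"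

definition star_graph :: "('v, 'e) pre_digraph \<Rightarrow> 'v \<Rightarrow> nat \<Rightarrow> ('v + nat, 'e + nat) pre_digraph" where
  "star_graph E v\<^sub>0 n = \<lparr>
     verts = Inl ` verts E \<union> Inr ` {1..n},
     arcs = Inl ` arcs E \<union> Inr ` {1..n},
     tail = (\<lambda>a. case a of Inl e \<Rightarrow> Inl (tail E e) | Inr i \<Rightarrow> chain_vertex v\<^sub>0 i),
     head = (\<lambda>a. case a of Inl e \<Rightarrow> Inl (head E e) | Inr i \<Rightarrow> chain_vertex v\<^sub>0 0) \<rparr>"

end

theory Submission
  imports Defs
begin

text \<open>
  In both graphs \<open>v\<^sub>i\<close> emits exactly one edge, so that edge and its ghost implement a Murray--von
  Neumann equivalence between \<open>v\<^sub>i\<close> and the range of the edge, and these equivalences exhaust the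
  relations involving the new edges. Equivalences compose: writing \<open>e\<^sub>i\<close> for the new edges of the
  chain, \<open>f\<^sub>i\<close> for those of the star and \<open>f\<^sub>0 = v\<^sub>0\<close>, the assignments \<open>e\<^sub>i \<mapsto> f\<^sub>i f\<^bsub>i-1\<^esub>\<^sup>*\<close> and
  \<open>f\<^sub>i \<mapsto> e\<^sub>i e\<^bsub>i-1\<^esub> \<dots> e\<^sub>1\<close> define mutually inverse homomorphisms.
\<close>

section \<open>Substitution homomorphisms of free algebras\<close>

lemma poly_mapping_sum_singles:
  "p = (\<Sum>w\<in>Poly_Mapping.keys p. Poly_Mapping.single w (Poly_Mapping.lookup p w))"
proof (rule poly_mapping_eqI)
  fix u
  show "Poly_Mapping.lookup p u = Poly_Mapping.lookup
      (\<Sum>w\<in>Poly_Mapping.keys p. Poly_Mapping.single w (Poly_Mapping.lookup p w)) u"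
    by (simp add: lookup_sum lookup_single when_def in_keys_iff)
qed

lemma poly_mapping_single_induct [case_names single sum]:
  fixes p :: "'a \<Rightarrow>\<^sub>0 'b::comm_monoid_add"
  assumes "\<And>w c. P (Poly_Mapping.single w c)" and add: "\<And>p q. P p \<Longrightarrow> P q \<Longrightarrow> P (p + q)"
  shows "P p"
proof -
  \<comment> \<open>A monomial with coefficient 0 gives the base case. It also covers sums over
    infinite sets, which are 0 by convention.\<close>
  have "P 0" using assms(1)[of _ 0] by simp
  then have "P (\<Sum>w\<in>A. Poly_Mapping.single w (f w))" for A f
    by (induction A rule: infinite_finite_induct) (simp_all add: assms)
  then show ?thesis by (subst poly_mapping_sum_singles)
qed

section \<open>Scalars acting on the free algebra\<close>

lemma free_scale_zero [simp]: "free_scale 0 p = 0"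
  by (simp add: free_scale_conv_mult)

lemma free_scale_one [simp]: "free_scale 1 p = p"
  by (simp add: free_scale_conv_mult)

lemma free_scale_add_left: "free_scale (a + b) p = free_scale a p + free_scale b p"
  by (simp add: free_scale_conv_mult single_add distrib_right)

lemma free_scale_add_right: "free_scale a (p + q) = free_scale a p + free_scale a q"
  by (simp add: free_scale_conv_mult distrib_left)

lemma free_scale_scale: "free_scale a (free_scale b p) = free_scale (a * b) p"
  by (simp add: free_scale_conv_mult mult.assoc[symmetric] mult_single)

lemma free_scale_single: "free_scale a (Poly_Mapping.single w b) = Poly_Mapping.single w (a * b)"
  by (simp add: free_scale_conv_mult mult_single)

lemma free_scale_mult_left: "free_scale a p * q = free_scale a (p * q)"
  by (simp add: free_scale_conv_mult mult.assoc)

text \<open>Scalar multiples of the empty word are central: they commute with monomials because the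
  field is commutative and the empty word is neutral.\<close>

lemma free_scale_mult_right: "p * free_scale a q = free_scale a (p * q)"
proof -
  have "p * Poly_Mapping.single 0 a = Poly_Mapping.single 0 a * p"
  proof (induction p rule: poly_mapping_single_induct)
    case (single k v)
    then show ?case by (simp add: mult_single mult.commute)
  next
    case (sum f g)
    then show ?case by (simp add: distrib_left distrib_right)
  qed
  then show ?thesis
    by (simp add: free_scale_conv_mult mult.assoc[symmetric])
qed

text \<open>The unital algebra homomorphism that the universal property of the free algebra attaches
  to \<open>\<sigma>\<close>; the empty word goes to 1.\<close>

definition free_subst ::
    "('x \<Rightarrow> 'y fword \<Rightarrow>\<^sub>0 'k) \<Rightarrow> ('x fword \<Rightarrow>\<^sub>0 'k::field) \<Rightarrow> ('y fword \<Rightarrow>\<^sub>0 'k)" where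
  "free_subst \<sigma> p =
     (\<Sum>w\<in>Poly_Mapping.keys p. free_scale (Poly_Mapping.lookup p w) (prod_list (map \<sigma> (letters w))))"

text \<open>Coefficients off the support vanish. Additivity needs a common index set, since
  cancellation may shrink the support of a sum.\<close>

lemma free_subst_superset:
  assumes "finite A" "Poly_Mapping.keys p \<subseteq> A"
  shows "free_subst \<sigma> p =
    (\<Sum>w\<in>A. free_scale (Poly_Mapping.lookup p w) (prod_list (map \<sigma> (letters w))))"
  unfolding free_subst_def using assms
  by (intro sum.mono_neutral_left) (auto simp: in_keys_iff)

lemma free_subst_zero [simp]: "free_subst \<sigma> 0 = 0"
  by (simp add: free_subst_def)

lemma free_subst_add: "free_subst \<sigma> (p + q) = free_subst \<sigma> p + free_subst \<sigma> q"
proof -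
  let ?A = "Poly_Mapping.keys p \<union> Poly_Mapping.keys q"
  show ?thesis
    using Poly_Mapping.keys_add[of p q]
    by (simp add: free_subst_superset[of ?A] lookup_add free_scale_add_left sum.distrib)
qed

lemma free_subst_single:
  "free_subst \<sigma> (Poly_Mapping.single w c) = free_scale c (prod_list (map \<sigma> (letters w)))"
  by (cases "c = 0") (simp_all add: free_subst_def)

lemma free_subst_gen [simp]: "free_subst \<sigma> (gen x) = \<sigma> x"
  by (simp add: gen_def free_subst_single)

lemma free_subst_scale: "free_subst \<sigma> (free_scale c p) = free_scale c (free_subst \<sigma> p)"
  by (induction p rule: poly_mapping_single_induct)
    (simp_all add: free_scale_single free_subst_single free_scale_scale
      free_scale_add_right free_subst_add)

lemma free_subst_diff: "free_subst \<sigma> (p - q) = free_subst \<sigma> p - free_subst \<sigma> q"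
  using free_subst_add[of \<sigma> "p - q" q] by (simp add: algebra_simps)

lemma free_subst_sum: "free_subst \<sigma> (\<Sum>i\<in>I. f i) = (\<Sum>i\<in>I. free_subst \<sigma> (f i))"
  by (induction I rule: infinite_finite_induct) (simp_all add: free_subst_add)

text \<open>Both sides are bilinear, so monomials suffice; there concatenation of words becomes
  multiplication of the two products.\<close>

lemma free_subst_mult: "free_subst \<sigma> (p * q) = free_subst \<sigma> p * free_subst \<sigma> q"
proof (induction p rule: poly_mapping_single_induct)
  case (single w c)
  show ?case
  proof (induction q rule: poly_mapping_single_induct)
    case (single u d)
    show ?case
      by (simp add: mult_single free_subst_single plus_fword_def free_scale_mult_left
          free_scale_mult_right free_scale_scale mult.commute)
  next
    case (sum f g)
    then show ?case by (simp add: distrib_left free_subst_add)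
  qed
next
  case (sum f g)
  then show ?case by (simp add: distrib_right free_subst_add)
qed

section \<open>The free algebra without unit\<close>

lemma zero_in_free_alg: "0 \<in> free_alg X"
  by (simp add: free_alg_def)

lemma gen_in_free_alg: "x \<in> X \<Longrightarrow> gen x \<in> free_alg X"
  by (simp add: free_alg_def gen_def)

lemma free_alg_sum: "(\<And>i. i \<in> I \<Longrightarrow> f i \<in> free_alg X) \<Longrightarrow> (\<Sum>i\<in>I. f i) \<in> free_alg X"
  by (induction I rule: infinite_finite_induct) (auto intro: zero_in_free_alg free_alg_add)

text \<open>Every element is a linear combination of nonempty words, and these are products of
  generators, so no case for the unit arises.\<close>

lemma free_alg_induct [consumes 1, case_names zero gen add mult scale]:
  assumes "p \<in> free_alg X"
    and "P 0"
    and gen: "\<And>x. x \<in> X \<Longrightarrow> P (gen x)"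
    and add: "\<And>p q. p \<in> free_alg X \<Longrightarrow> q \<in> free_alg X \<Longrightarrow> P p \<Longrightarrow> P q \<Longrightarrow> P (p + q)"
    and mult: "\<And>p q. p \<in> free_alg X \<Longrightarrow> q \<in> free_alg X \<Longrightarrow> P p \<Longrightarrow> P q \<Longrightarrow> P (p * q)"
    and scale: "\<And>c p. p \<in> free_alg X \<Longrightarrow> P p \<Longrightarrow> P (free_scale c p)"
  shows "P p"
proof -
  \<comment> \<open>Words grow from single letters because the empty word lies outside
    \<open>free_alg X\<close>. Membership is carried along since \<open>mult\<close> asks for
    it.\<close>
  have word: "P (Poly_Mapping.single (FWord l) 1) \<and> Poly_Mapping.single (FWord l) (1::'b) \<in> free_alg X"
    if "l \<noteq> []" "set l \<subseteq> X" for l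
    using that
  proof (induction l rule: list_nonempty_induct)
    case (single x)
    then show ?case
      using gen[of x] gen_in_free_alg[of x X] by (simp add: gen_def)
  next
    case (cons x xs)
    have "Poly_Mapping.single (FWord (x # xs)) 1 = gen x * Poly_Mapping.single (FWord xs) (1::'b)"
      by (simp add: gen_def mult_single plus_fword_def)
    then show ?case
      using cons by (auto intro: mult gen gen_in_free_alg free_alg_mult)
  qed
  have monom: "P (Poly_Mapping.single w c) \<and> Poly_Mapping.single w c \<in> free_alg X"
    if "w \<in> Poly_Mapping.keys p" for w c
  proof -
    obtain l where w: "w = FWord l" by (cases w)
    then have l: "l \<noteq> []" "set l \<subseteq> X"
      using assms(1) that by (force simp: free_alg_def)+
    have "Poly_Mapping.single w c = free_scale c (Poly_Mapping.single (FWord l) 1)"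
      by (simp add: w free_scale_single)
    then show ?thesis
      using word[OF l] by (auto intro: scale free_alg_scale)
  qed
  have "P (\<Sum>w\<in>A. Poly_Mapping.single w (f w)) \<and> (\<Sum>w\<in>A. Poly_Mapping.single w (f w)) \<in> free_alg X"
    if "finite A" "A \<subseteq> Poly_Mapping.keys p" for A f
    using that
    by (induction A rule: finite_induct) (auto intro: add monom[THEN conjunct1]
        monom[THEN conjunct2] free_alg_add zero_in_free_alg assms(2))
  from this[of "Poly_Mapping.keys p" "Poly_Mapping.lookup p"] show ?thesis
    using poly_mapping_sum_singles[of p] by simp
qed

lemma free_subst_in_free_alg:
  assumes "\<And>x. x \<in> X \<Longrightarrow> \<sigma> x \<in> free_alg Y" and "p \<in> free_alg X"
  shows "free_subst \<sigma> p \<in> free_alg Y"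
  using assms(2)
  by (induction rule: free_alg_induct)
    (simp_all add: assms(1) zero_in_free_alg free_subst_add free_subst_mult free_subst_scale
      free_alg_add free_alg_mult free_alg_scale)

text \<open>Relators suffice: multipliers from \<open>free_alg X\<close> are sent into
  \<open>free_alg Y\<close>, so they are admissible multipliers for the target ideal.\<close>

lemma free_subst_gen_ideal:
  assumes "\<And>x. x \<in> X \<Longrightarrow> \<sigma> x \<in> free_alg Y"
    and "\<And>r. r \<in> R \<Longrightarrow> free_subst \<sigma> r \<in> gen_ideal Y S" and "p \<in> gen_ideal X R"
  shows "free_subst \<sigma> p \<in> gen_ideal Y S"
  using assms(3)
  by induction (simp_all add: assms(2) free_subst_add free_subst_mult free_subst_scale
      gen_ideal.intros free_subst_in_free_alg[of X \<sigma> Y, OF assms(1)])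


section \<open>Presented algebras\<close>

lemma pres_rel_refl: "p \<in> free_alg X \<Longrightarrow> (p, p) \<in> pres_rel X R"
  by (simp add: pres_rel_def gen_ideal.zero)

lemma pres_rel_sym: "(p, q) \<in> pres_rel X R \<Longrightarrow> (q, p) \<in> pres_rel X R"
  using equiv_pres_rel[of X R] by (meson equivE symD)

lemma pres_rel_trans [trans]:
  "(p, q) \<in> pres_rel X R \<Longrightarrow> (q, r) \<in> pres_rel X R \<Longrightarrow> (p, r) \<in> pres_rel X R"
  using equiv_pres_rel[of X R] by (meson equivE transD)

lemma pres_rel_in_free_alg:
  "(p, q) \<in> pres_rel X R \<Longrightarrow> p \<in> free_alg X"
  "(p, q) \<in> pres_rel X R \<Longrightarrow> q \<in> free_alg X"
  by (simp_all add: pres_rel_def)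

lemma pres_rel_diff_in_gen_ideal: "(p, q) \<in> pres_rel X R \<Longrightarrow> p - q \<in> gen_ideal X R"
  by (simp add: pres_rel_def)

text \<open>The composite is a homomorphism and \<open>pres_rel\<close> is a congruence, so
  agreement with the identity spreads from the generators.\<close>

lemma free_subst_inverse:
  assumes "\<And>x. x \<in> X \<Longrightarrow> (free_subst \<tau> (\<sigma> x), gen x) \<in> pres_rel X R" and "p \<in> free_alg X"
  shows "(free_subst \<tau> (free_subst \<sigma> p), p) \<in> pres_rel X R"
  using assms(2)
  by (induction rule: free_alg_induct)
    (simp_all add: assms(1) zero_in_free_alg pres_rel_refl free_subst_add free_subst_mult
      free_subst_scale pres_rel_add pres_rel_mult pres_rel_scale)

text \<open>Von Dyck's argument in both directions: substitutions sending relators into the target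
  ideal descend to the quotients, and being inverse on generators makes the induced maps
  inverse.\<close>

lemma presented_alg_isomorphicI:
  fixes \<sigma> :: "'x \<Rightarrow> 'y fword \<Rightarrow>\<^sub>0 'k::field"
  assumes \<sigma>: "\<And>x. x \<in> X \<Longrightarrow> \<sigma> x \<in> free_alg Y"
    and \<tau>: "\<And>y. y \<in> Y \<Longrightarrow> \<tau> y \<in> free_alg X"
    and R: "\<And>r. r \<in> R \<Longrightarrow> free_subst \<sigma> r \<in> gen_ideal Y S"
    and S: "\<And>r. r \<in> S \<Longrightarrow> free_subst \<tau> r \<in> gen_ideal X R"
    and \<tau>\<sigma>: "\<And>x. x \<in> X \<Longrightarrow> (free_subst \<tau> (\<sigma> x), gen x) \<in> pres_rel X R"
    and \<sigma>\<tau>: "\<And>y. y \<in> Y \<Longrightarrow> (free_subst \<sigma> (\<tau> y), gen y) \<in> pres_rel Y S"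
  shows "presented_alg X R \<cong>\<^sub>a presented_alg Y S"
proof -
  let ?A = "presented_alg X R" and ?B = "presented_alg Y S"
  let ?c = "\<lambda>p. pres_rel X R `` {p}" and ?d = "\<lambda>p. pres_rel Y S `` {p}"
  have carA: "carrier ?A = ?c ` free_alg X" and carB: "carrier ?B = ?d ` free_alg Y"
    by (auto simp: presented_alg_def quotient_def)
  have c_eq: "?c p = ?c q \<longleftrightarrow> (p, q) \<in> pres_rel X R" if "p \<in> free_alg X" "q \<in> free_alg X" for p q
    using eq_equiv_class_iff[OF equiv_pres_rel that] .
  have d_eq: "?d p = ?d q \<longleftrightarrow> (p, q) \<in> pres_rel Y S" if "p \<in> free_alg Y" "q \<in> free_alg Y" for p q
    using eq_equiv_class_iff[OF equiv_pres_rel that] .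
  have \<sigma>F: "free_subst \<sigma> p \<in> free_alg Y" if "p \<in> free_alg X" for p
    using free_subst_in_free_alg[of X \<sigma> Y p] \<sigma> that by blast
  have \<tau>F: "free_subst \<tau> p \<in> free_alg X" if "p \<in> free_alg Y" for p
    using free_subst_in_free_alg[of Y \<tau> X p] \<tau> that by blast
  have \<sigma>R: "(free_subst \<sigma> p, free_subst \<sigma> q) \<in> pres_rel Y S" if "(p, q) \<in> pres_rel X R" for p q
    using that free_subst_gen_ideal[of X \<sigma> Y R S "p - q"] \<sigma> R \<sigma>F
    by (simp add: pres_rel_def free_subst_diff)
  have \<tau>S: "(free_subst \<tau> p, free_subst \<tau> q) \<in> pres_rel X R" if "(p, q) \<in> pres_rel Y S" for p q
    using that free_subst_gen_ideal[of Y \<tau> X S R "p - q"] \<tau> S \<tau>F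
    by (simp add: pres_rel_def free_subst_diff)
  have inv1: "(free_subst \<tau> (free_subst \<sigma> p), p) \<in> pres_rel X R" if "p \<in> free_alg X" for p
    using free_subst_inverse[of X \<tau> \<sigma> R p] \<tau>\<sigma> that by blast
  have inv2: "(free_subst \<sigma> (free_subst \<tau> p), p) \<in> pres_rel Y S" if "p \<in> free_alg Y" for p
    using free_subst_inverse[of Y \<sigma> \<tau> S p] \<sigma>\<tau> that by blast
  \<comment> \<open>The induced map is evaluated at a chosen representative;
    \<open>\<sigma>R\<close> makes the choice immaterial.\<close>
  define h where "h A = ?d (free_subst \<sigma> (SOME p. p \<in> A))" for A
  have h: "h (?c p) = ?d (free_subst \<sigma> p)" if "p \<in> free_alg X" for p
  proof -
    have "p \<in> ?c p" using that by (simp add: pres_rel_refl)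
    then have "(SOME q. q \<in> ?c p) \<in> ?c p" by (rule someI)
    then have "(p, SOME q. q \<in> ?c p) \<in> pres_rel X R" by simp
    from \<sigma>R[OF this] show ?thesis
      unfolding h_def using equiv_class_eq[OF equiv_pres_rel] by metis
  qed
  have "inj_on h (carrier ?A)"
  proof (rule inj_onI)
    fix A B assume "A \<in> carrier ?A" "B \<in> carrier ?A" and eq: "h A = h B"
    then obtain p q where p: "A = ?c p" "p \<in> free_alg X" and q: "B = ?c q" "q \<in> free_alg X"
      unfolding carA by blast
    have "(free_subst \<sigma> p, free_subst \<sigma> q) \<in> pres_rel Y S"
      using eq p q by (simp add: h d_eq \<sigma>F)
    from \<tau>S[OF this] have "(p, q) \<in> pres_rel X R"
      using inv1[OF p(2)] inv1[OF q(2)] by (meson pres_rel_sym pres_rel_trans)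
    then show "A = B" using p q by (simp add: c_eq)
  qed
  moreover have "h ` carrier ?A = carrier ?B"
  proof
    show "h ` carrier ?A \<subseteq> carrier ?B"
      by (auto simp: carA carB h \<sigma>F)
    show "carrier ?B \<subseteq> h ` carrier ?A"
    proof
      fix B assume "B \<in> carrier ?B"
      then obtain q where q: "B = ?d q" "q \<in> free_alg Y"
        unfolding carB by blast
      have "h (?c (free_subst \<tau> q)) = B"
        using q inv2 by (simp add: h \<tau>F d_eq \<sigma>F)
      then show "B \<in> h ` carrier ?A"
        using \<tau>F[OF q(2)] unfolding carA by blast
    qed
  qed
  ultimately have "alg_iso ?A ?B h"
    unfolding alg_iso_def bij_betw_def carA
    by (auto simp: h \<sigma>F presented_alg_add presented_alg_mul presented_alg_scale
        free_alg_add free_alg_mult free_alg_scale free_subst_add free_subst_mult free_subst_scale)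
  then show ?thesis
    unfolding alg_isomorphic_def by blast
qed

section \<open>Products modulo the relations\<close>

lemma pres_rel_mult_left:
  "a \<in> free_alg X \<Longrightarrow> (p, q) \<in> pres_rel X R \<Longrightarrow> (a * p, a * q) \<in> pres_rel X R"
  by (intro pres_rel_mult pres_rel_refl)

lemma pres_rel_mult_right:
  "a \<in> free_alg X \<Longrightarrow> (p, q) \<in> pres_rel X R \<Longrightarrow> (p * a, q * a) \<in> pres_rel X R"
  by (intro pres_rel_mult pres_rel_refl)

text \<open>The inner product equals u, a right unit of a, and is absorbed. When equivalences are
  composed, u is the middle idempotent.\<close>

lemma pres_rel_collapse:
  assumes "(b * c, u) \<in> pres_rel X R" "(a * u, a) \<in> pres_rel X R" "d \<in> free_alg X"
  shows "((a * b) * (c * d), a * d) \<in> pres_rel X R"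
proof -
  have a: "a \<in> free_alg X" using assms(2) by (rule pres_rel_in_free_alg)
  have "(a * b) * (c * d) = (a * (b * c)) * d" by (simp add: mult.assoc)
  also have "(\<dots>, (a * u) * d) \<in> pres_rel X R"
    by (intro pres_rel_mult_right pres_rel_mult_left assms a)
  also have "((a * u) * d, a * d) \<in> pres_rel X R"
    by (intro pres_rel_mult_right assms)
  finally show ?thesis .
qed

text \<open>Inserting the right unit u of a and the left unit v of b puts u v between them. This
  yields e^* f = 0 for edges with different sources.\<close>

lemma pres_rel_orthogonal:
  assumes "(a * u, a) \<in> pres_rel X R" "(v * b, b) \<in> pres_rel X R" "(u * v, 0) \<in> pres_rel X R"
  shows "(a * b, 0) \<in> pres_rel X R"
proof -
  have a: "a \<in> free_alg X" and b: "b \<in> free_alg X"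
    using assms(1,2) by (auto dest: pres_rel_in_free_alg)
  have "(a * b, (a * u) * (v * b)) \<in> pres_rel X R"
    by (intro pres_rel_mult pres_rel_sym[OF assms(1)] pres_rel_sym[OF assms(2)])
  also have "(a * u) * (v * b) = a * (u * v) * b" by (simp add: mult.assoc)
  also have "(a * (u * v) * b, a * 0 * b) \<in> pres_rel X R"
    by (intro pres_rel_mult_right pres_rel_mult_left assms a b)
  finally show ?thesis by simp
qed


section \<open>Relations in Leavitt path algebras\<close>

text \<open>Equality in L_K(G) of the represented classes. As \<open>pres_rel\<close> includes
  membership in \<open>free_alg\<close>, each equation also certifies that both sides are built from
  generators of G.\<close>

abbreviation lpa_eq ::
    "(('v, 'e) lpa_gen fword \<Rightarrow>\<^sub>0 'k::field) \<Rightarrow> ('v, 'e) pre_digraph \<Rightarrow>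
     (('v, 'e) lpa_gen fword \<Rightarrow>\<^sub>0 'k) \<Rightarrow> bool" ("_ \<approx>\<^bsub>_\<^esub> _" [51, 0, 51] 50) where
  "p \<approx>\<^bsub>G\<^esub> q \<equiv> (p, q) \<in> pres_rel (lpa_gens G) (lpa_relators G)"

section \<open>The defining relations as equations\<close>

lemma lpa_gens_in_free_alg:
  "v \<in> verts G \<Longrightarrow> gen (Vertex v) \<in> free_alg (lpa_gens G)"
  "e \<in> arcs G \<Longrightarrow> gen (Edge e) \<in> free_alg (lpa_gens G)"
  "e \<in> arcs G \<Longrightarrow> gen (Ghost e) \<in> free_alg (lpa_gens G)"
  by (auto intro!: gen_in_free_alg simp: lpa_gens_def)

lemma lpa_eqI:
  "p - q \<in> lpa_relators G \<Longrightarrow> p \<in> free_alg (lpa_gens G) \<Longrightarrow> q \<in> free_alg (lpa_gens G) \<Longrightarrow> p \<approx>\<^bsub>G\<^esub> q"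
  by (simp add: pres_rel_def gen_ideal.base)

lemma lpa_vertices:
  assumes "v \<in> verts G" "w \<in> verts G"
  shows "gen (Vertex v) * gen (Vertex w) \<approx>\<^bsub>G\<^esub>
    (if v = w then gen (Vertex w) else 0 :: _ \<Rightarrow>\<^sub>0 'k::field)"
  using lpa_relators.vertices[OF assms]
  by (rule lpa_eqI) (simp_all add: assms lpa_gens_in_free_alg free_alg_mult zero_in_free_alg)

context wf_digraph
begin

lemma lpa_edge_source: "e \<in> arcs G \<Longrightarrow>
    gen (Vertex (tail G e)) * gen (Edge e) \<approx>\<^bsub>G\<^esub> (gen (Edge e) :: _ \<Rightarrow>\<^sub>0 'k::field)"
  by (rule lpa_eqI) (simp_all add: lpa_relators.edge_source lpa_gens_in_free_alg free_alg_mult)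

lemma lpa_edge_range: "e \<in> arcs G \<Longrightarrow>
    gen (Edge e) * gen (Vertex (head G e)) \<approx>\<^bsub>G\<^esub> (gen (Edge e) :: _ \<Rightarrow>\<^sub>0 'k::field)"
  by (rule lpa_eqI) (simp_all add: lpa_relators.edge_range lpa_gens_in_free_alg free_alg_mult)

lemma lpa_ghost_range: "e \<in> arcs G \<Longrightarrow>
    gen (Vertex (head G e)) * gen (Ghost e) \<approx>\<^bsub>G\<^esub> (gen (Ghost e) :: _ \<Rightarrow>\<^sub>0 'k::field)"
  by (rule lpa_eqI) (simp_all add: lpa_relators.ghost_range lpa_gens_in_free_alg free_alg_mult)

lemma lpa_ghost_source: "e \<in> arcs G \<Longrightarrow>
    gen (Ghost e) * gen (Vertex (tail G e)) \<approx>\<^bsub>G\<^esub> (gen (Ghost e) :: _ \<Rightarrow>\<^sub>0 'k::field)"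
  by (rule lpa_eqI) (simp_all add: lpa_relators.ghost_source lpa_gens_in_free_alg free_alg_mult)

lemma lpa_CK1:
  assumes "e \<in> arcs G" "f \<in> arcs G"
  shows "gen (Ghost e) * gen (Edge f) \<approx>\<^bsub>G\<^esub> 
    (if e = f then gen (Vertex (head G e)) else 0 :: _ \<Rightarrow>\<^sub>0 'k::field)"
  using lpa_relators.CK1[OF assms]
  by (rule lpa_eqI) (simp_all add: assms lpa_gens_in_free_alg free_alg_mult zero_in_free_alg)

lemma lpa_CK2:
  assumes "regular_vertex G v"
  shows "gen (Vertex v) \<approx>\<^bsub>G\<^esub>
    (\<Sum>e\<in>out_arcs G v. gen (Edge e) * gen (Ghost e) :: _ \<Rightarrow>\<^sub>0 'k::field)"
  using lpa_relators.CK2[OF assms]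
  by (rule lpa_eqI) (use assms in \<open>auto intro!: free_alg_sum free_alg_mult lpa_gens_in_free_alg
      simp: regular_vertex_def\<close>)

end

text \<open>The universal property of L_K(G), one premise per family of relators. Premises are
  equations modulo S, so that they can be proved by calculation.\<close>

lemma free_subst_lpa_relators:
  assumes "\<And>v w. v \<in> verts G \<Longrightarrow> w \<in> verts G \<Longrightarrow>
      (\<sigma> (Vertex v) * \<sigma> (Vertex w), if v = w then \<sigma> (Vertex w) else 0) \<in> pres_rel Y S"
    and "\<And>e. e \<in> arcs G \<Longrightarrow> (\<sigma> (Vertex (tail G e)) * \<sigma> (Edge e), \<sigma> (Edge e)) \<in> pres_rel Y S"
    and "\<And>e. e \<in> arcs G \<Longrightarrow> (\<sigma> (Edge e) * \<sigma> (Vertex (head G e)), \<sigma> (Edge e)) \<in> pres_rel Y S"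
    and "\<And>e. e \<in> arcs G \<Longrightarrow> (\<sigma> (Vertex (head G e)) * \<sigma> (Ghost e), \<sigma> (Ghost e)) \<in> pres_rel Y S"
    and "\<And>e. e \<in> arcs G \<Longrightarrow> (\<sigma> (Ghost e) * \<sigma> (Vertex (tail G e)), \<sigma> (Ghost e)) \<in> pres_rel Y S"
    and "\<And>e f. e \<in> arcs G \<Longrightarrow> f \<in> arcs G \<Longrightarrow>
      (\<sigma> (Ghost e) * \<sigma> (Edge f), if e = f then \<sigma> (Vertex (head G e)) else 0) \<in> pres_rel Y S"
    and "\<And>v. regular_vertex G v \<Longrightarrow>
      (\<sigma> (Vertex v), \<Sum>e\<in>out_arcs G v. \<sigma> (Edge e) * \<sigma> (Ghost e)) \<in> pres_rel Y S"
    and "r \<in> lpa_relators G"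
  shows "free_subst \<sigma> r \<in> gen_ideal Y S"
  using assms(8)
  by cases (simp_all only: free_subst_diff free_subst_mult free_subst_sum free_subst_gen
      free_subst_zero if_distrib[of "free_subst \<sigma>"] pres_rel_diff_in_gen_ideal assms(1-7))

text \<open>Murray--von Neumann equivalence of the idempotents \<open>v\<close> and \<open>w\<close>, implemented by \<open>a\<close> and \<open>b\<close>.\<close>

definition lpa_equivalent ::
    "('v, 'e) pre_digraph \<Rightarrow> 'v \<Rightarrow> 'v \<Rightarrow> (('v, 'e) lpa_gen fword \<Rightarrow>\<^sub>0 'k::field) \<Rightarrow>
     (('v, 'e) lpa_gen fword \<Rightarrow>\<^sub>0 'k) \<Rightarrow> bool" where
  "lpa_equivalent G v w a b \<longleftrightarrow>
     gen (Vertex v) * a \<approx>\<^bsub>G\<^esub> a \<and> a * gen (Vertex w) \<approx>\<^bsub>G\<^esub> a \<and>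
     gen (Vertex w) * b \<approx>\<^bsub>G\<^esub> b \<and> b * gen (Vertex v) \<approx>\<^bsub>G\<^esub> b \<and>
     a * b \<approx>\<^bsub>G\<^esub> gen (Vertex v) \<and> b * a \<approx>\<^bsub>G\<^esub> gen (Vertex w)"

lemma lpa_equivalentD:
  assumes "lpa_equivalent G v w a b"
  shows "gen (Vertex v) * a \<approx>\<^bsub>G\<^esub> a" "a * gen (Vertex w) \<approx>\<^bsub>G\<^esub> a"
    "gen (Vertex w) * b \<approx>\<^bsub>G\<^esub> b" "b * gen (Vertex v) \<approx>\<^bsub>G\<^esub> b"
    "a * b \<approx>\<^bsub>G\<^esub> gen (Vertex v)" "b * a \<approx>\<^bsub>G\<^esub> gen (Vertex w)"
    "a \<in> free_alg (lpa_gens G)" "b \<in> free_alg (lpa_gens G)"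
  using assms unfolding lpa_equivalent_def by (auto dest: pres_rel_in_free_alg)

lemma lpa_equivalent_refl:
  "v \<in> verts G \<Longrightarrow> lpa_equivalent G v v (gen (Vertex v)) (gen (Vertex v))"
  using lpa_vertices[of v G v] by (simp add: lpa_equivalent_def)

lemma lpa_equivalent_sym: "lpa_equivalent G v w a b \<Longrightarrow> lpa_equivalent G w v b a"
  by (simp add: lpa_equivalent_def)

text \<open>The implementing elements multiply. In (a c)(d b) the middle c d is w, which a absorbs
  on the right; the other product is symmetric.\<close>

lemma lpa_equivalent_trans:
  assumes 1: "lpa_equivalent G v w a b" and 2: "lpa_equivalent G w u c d"
  shows "lpa_equivalent G v u (a * c) (d * b)"
proof -
  note D1 = lpa_equivalentD[OF 1] and D2 = lpa_equivalentD[OF 2]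
  have "gen (Vertex v) * (a * c) \<approx>\<^bsub>G\<^esub> a * c"
    using pres_rel_mult_right[OF D2(7) D1(1)] by (simp add: mult.assoc)
  moreover have "(a * c) * gen (Vertex u) \<approx>\<^bsub>G\<^esub> a * c"
    using pres_rel_mult_left[OF D1(7) D2(2)] by (simp add: mult.assoc)
  moreover have "gen (Vertex u) * (d * b) \<approx>\<^bsub>G\<^esub> d * b"
    using pres_rel_mult_right[OF D1(8) D2(3)] by (simp add: mult.assoc)
  moreover have "(d * b) * gen (Vertex v) \<approx>\<^bsub>G\<^esub> d * b"
    using pres_rel_mult_left[OF D2(8) D1(4)] by (simp add: mult.assoc)
  moreover have "(a * c) * (d * b) \<approx>\<^bsub>G\<^esub> gen (Vertex v)"
    using pres_rel_collapse[OF D2(5) D1(2) D1(8)] D1(5) by (rule pres_rel_trans)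
  moreover have "(d * b) * (a * c) \<approx>\<^bsub>G\<^esub> gen (Vertex u)"
    using pres_rel_collapse[OF D1(6) D2(4) D2(7)] D2(6) by (rule pres_rel_trans)
  ultimately show ?thesis
    unfolding lpa_equivalent_def by blast
qed

text \<open>The sum in CK2 at v has a single term, so e e^* = v, while CK1 gives e^* e =
  r(e).\<close>

lemma (in wf_digraph) lpa_equivalent_edge:
  assumes "out_arcs G v = {e}"
  shows "lpa_equivalent G v (head G e) (gen (Edge e)) (gen (Ghost e) :: _ \<Rightarrow>\<^sub>0 'k::field)"
proof -
  have e: "e \<in> arcs G" "tail G e = v" using assms by auto
  then have "regular_vertex G v"
    using assms by (auto simp: regular_vertex_def)
  note CK2 = pres_rel_sym[OF lpa_CK2[OF this, where 'k = 'k]]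
  show ?thesis
    using lpa_edge_source[OF e(1), where 'k = 'k] lpa_edge_range[OF e(1), where 'k = 'k]
      lpa_ghost_range[OF e(1), where 'k = 'k] lpa_ghost_source[OF e(1), where 'k = 'k]
      lpa_CK1[OF e(1) e(1), where 'k = 'k] CK2
    by (simp add: lpa_equivalent_def assms e(2))
qed


section \<open>Attaching edges with prescribed ranges\<close>

text \<open>
  A common generalisation of the chain and the star: the new edge \<open>e\<^sub>i\<close> goes from \<open>v\<^sub>i\<close> to \<open>h i\<close>.
\<close>

definition attach :: "('v, 'e) pre_digraph \<Rightarrow> 'v \<Rightarrow> nat \<Rightarrow> (nat \<Rightarrow> 'v + nat) \<Rightarrow>
    ('v + nat, 'e + nat) pre_digraph" where
  "attach E v\<^sub>0 n h = \<lparr>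
     verts = Inl ` verts E \<union> Inr ` {1..n},
     arcs = Inl ` arcs E \<union> Inr ` {1..n},
     tail = (\<lambda>a. case a of Inl e \<Rightarrow> Inl (tail E e) | Inr i \<Rightarrow> chain_vertex v\<^sub>0 i),
     head = (\<lambda>a. case a of Inl e \<Rightarrow> Inl (head E e) | Inr i \<Rightarrow> h i) \<rparr>"

lemma chain_graph_eq_attach: "chain_graph E v\<^sub>0 n = attach E v\<^sub>0 n (\<lambda>i. chain_vertex v\<^sub>0 (i - 1))"
  by (simp only: chain_graph_def attach_def)

lemma star_graph_eq_attach: "star_graph E v\<^sub>0 n = attach E v\<^sub>0 n (\<lambda>i. chain_vertex v\<^sub>0 0)"
  by (simp only: star_graph_def attach_def)

lemma attach_simps [simp]:
  "verts (attach E v\<^sub>0 n h) = Inl ` verts E \<union> Inr ` {1..n}"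
  "arcs (attach E v\<^sub>0 n h) = Inl ` arcs E \<union> Inr ` {1..n}"
  "tail (attach E v\<^sub>0 n h) (Inl e) = Inl (tail E e)"
  "tail (attach E v\<^sub>0 n h) (Inr i) = chain_vertex v\<^sub>0 i"
  "head (attach E v\<^sub>0 n h) (Inl e) = Inl (head E e)"
  "head (attach E v\<^sub>0 n h) (Inr i) = h i"
  by (simp_all add: attach_def)

text \<open>New edges have index at least 1, so none starts at an old vertex, not even at v_0. Hence
  CK2 at old vertices involves old edges only.\<close>

lemma out_arcs_attach_Inl: "out_arcs (attach E v\<^sub>0 n h) (Inl v) = Inl ` out_arcs E v"
  by (auto simp: out_arcs_def chain_vertex_def)

lemma out_arcs_attach_Inr: "i \<in> {1..n} \<Longrightarrow> out_arcs (attach E v\<^sub>0 n h) (Inr i) = {Inr i}"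
  by (auto simp: out_arcs_def chain_vertex_def)

lemma chain_vertex_in_attach:
  "v\<^sub>0 \<in> verts E \<Longrightarrow> i \<le> n \<Longrightarrow> chain_vertex v\<^sub>0 i \<in> verts (attach E v\<^sub>0 n h)"
  by (auto simp: chain_vertex_def)

lemma wf_digraph_attach:
  assumes "wf_digraph E" and "\<And>i. i \<in> {1..n} \<Longrightarrow> h i \<in> verts (attach E v\<^sub>0 n h)"
  shows "wf_digraph (attach E v\<^sub>0 n h)"
proof
  fix e assume e: "e \<in> arcs (attach E v\<^sub>0 n h)"
  show "tail (attach E v\<^sub>0 n h) e \<in> verts (attach E v\<^sub>0 n h)"
    using e wf_digraph.tail_in_verts[OF assms(1)] by (auto simp: chain_vertex_def)
  show "head (attach E v\<^sub>0 n h) e \<in> verts (attach E v\<^sub>0 n h)"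
  proof (cases e)
    case (Inl a)
    then show ?thesis using e wf_digraph.head_in_verts[OF assms(1)] by auto
  next
    case (Inr i)
    then show ?thesis using e assms(2)[of i] by auto
  qed
qed

lemma lpa_equivalent_attach:
  assumes "wf_digraph (attach E v\<^sub>0 n h)" and i: "i \<in> {1..n}"
  shows "lpa_equivalent (attach E v\<^sub>0 n h) (chain_vertex v\<^sub>0 i) (h i)
    (gen (Edge (Inr i))) (gen (Ghost (Inr i)))"
  using wf_digraph.lpa_equivalent_edge[OF assms(1) out_arcs_attach_Inr[OF i]] i
  by (simp add: chain_vertex_def)

text \<open>One scheme for both directions: the generators of \<open>attach\<close> do not depend on
  the prescribed ranges, so only new edges and their ghosts need new images.\<close>

fun attach_subst ::
    "(nat \<Rightarrow> ('v, 'e + nat) lpa_gen fword \<Rightarrow>\<^sub>0 'k::field) \<Rightarrow>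
     (nat \<Rightarrow> ('v, 'e + nat) lpa_gen fword \<Rightarrow>\<^sub>0 'k) \<Rightarrow>
     ('v, 'e + nat) lpa_gen \<Rightarrow> ('v, 'e + nat) lpa_gen fword \<Rightarrow>\<^sub>0 'k" where
  "attach_subst F D (Vertex v) = gen (Vertex v)"
| "attach_subst F D (Edge (Inl e)) = gen (Edge (Inl e))"
| "attach_subst F D (Edge (Inr i)) = F i"
| "attach_subst F D (Ghost (Inl e)) = gen (Ghost (Inl e))"
| "attach_subst F D (Ghost (Inr i)) = D i"

lemma attach_subst_in_free_alg:
  assumes "\<And>i. i \<in> {1..n} \<Longrightarrow>
      lpa_equivalent (attach E v\<^sub>0 n h') (chain_vertex v\<^sub>0 i) (h i) (F i) (D i)"
    and "x \<in> lpa_gens (attach E v\<^sub>0 n h)"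
  shows "attach_subst F D x \<in> free_alg (lpa_gens (attach E v\<^sub>0 n h'))"
  using assms(2) lpa_equivalentD(7,8)[OF assms(1)]
  by (auto simp: lpa_gens_def intro!: gen_in_free_alg)

text \<open>
  Since each \<open>v\<^sub>i\<close> emits only \<open>e\<^sub>i\<close>, all defining relations involving \<open>e\<^sub>i\<close> are contained in the
  statement that \<open>e\<^sub>i\<close> and its ghost implement an equivalence between \<open>v\<^sub>i\<close> and \<open>h i\<close>.
\<close>

lemma attach_subst_relators:
  fixes F :: "nat \<Rightarrow> ('v + nat, 'e + nat) lpa_gen fword \<Rightarrow>\<^sub>0 'k::field"
  assumes wf: "wf_digraph (attach E v\<^sub>0 n h')"
    and FD: "\<And>i. i \<in> {1..n} \<Longrightarrow>
      lpa_equivalent (attach E v\<^sub>0 n h') (chain_vertex v\<^sub>0 i) (h i) (F i) (D i)"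
    and "r \<in> lpa_relators (attach E v\<^sub>0 n h)"
  shows "free_subst (attach_subst F D) r \<in>
    gen_ideal (lpa_gens (attach E v\<^sub>0 n h')) (lpa_relators (attach E v\<^sub>0 n h'))"
proof (rule free_subst_lpa_relators[OF _ _ _ _ _ _ _ assms(3)])
  let ?G = "attach E v\<^sub>0 n h" and ?H = "attach E v\<^sub>0 n h'"
  let ?s = "attach_subst F D"
  interpret H: wf_digraph ?H by fact
  show "?s (Vertex v) * ?s (Vertex w) \<approx>\<^bsub>?H\<^esub> (if v = w then ?s (Vertex w) else 0)"
    if "v \<in> verts ?G" "w \<in> verts ?G" for v w
    unfolding attach_subst.simps by (rule lpa_vertices) (use that in simp_all)
  \<comment> \<open>For old edges this is a relation of the target graph; for new ones it is part of
    the equivalence \<open>FD\<close>. The next three relations split likewise.\<close>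
  show source: "?s (Vertex (tail ?G e)) * ?s (Edge e) \<approx>\<^bsub>?H\<^esub> ?s (Edge e)" if "e \<in> arcs ?G" for e
    using that H.lpa_edge_source[of e, where 'k = 'k] lpa_equivalentD(1)[OF FD] by (cases e) auto
  show "?s (Edge e) * ?s (Vertex (head ?G e)) \<approx>\<^bsub>?H\<^esub> ?s (Edge e)" if "e \<in> arcs ?G" for e
    using that H.lpa_edge_range[of e, where 'k = 'k] lpa_equivalentD(2)[OF FD] by (cases e) auto
  show "?s (Vertex (head ?G e)) * ?s (Ghost e) \<approx>\<^bsub>?H\<^esub> ?s (Ghost e)" if "e \<in> arcs ?G" for e
    using that H.lpa_ghost_range[of e, where 'k = 'k] lpa_equivalentD(3)[OF FD] by (cases e) auto
  show ghost_source: "?s (Ghost e) * ?s (Vertex (tail ?G e)) \<approx>\<^bsub>?H\<^esub> ?s (Ghost e)"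
    if "e \<in> arcs ?G" for e
    using that H.lpa_ghost_source[of e, where 'k = 'k] lpa_equivalentD(4)[OF FD] by (cases e) auto
  show "?s (Ghost e) * ?s (Edge f) \<approx>\<^bsub>?H\<^esub> (if e = f then ?s (Vertex (head ?G e)) else 0)"
    if e: "e \<in> arcs ?G" and f: "f \<in> arcs ?G" for e f
  proof -
    have tails: "tail ?G e \<in> verts ?H" "tail ?G f \<in> verts ?H"
      using e f H.tail_in_verts[of e] H.tail_in_verts[of f] by (auto split: sum.splits)
    \<comment> \<open>Distinct edges with a common source must both be old, and for those CK1 of the
      target applies. Any other distinct pair has orthogonal sources.\<close>
    consider (old) e' f' where "e = Inl e'" "f = Inl f'" | (new) i where "e = Inr i" "f = Inr i"
      | (orth) "e \<noteq> f" "tail ?G e \<noteq> tail ?G f"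
      using e f by (cases e; cases f; cases "e = f") (auto simp: chain_vertex_def)
    then show ?thesis
    proof cases
      case old
      then show ?thesis using H.lpa_CK1[of e f, where 'k = 'k] e f by auto
    next
      case new
      then show ?thesis using lpa_equivalentD(6)[OF FD] e by auto
    next
      case orth
      have "?s (Vertex (tail ?G e)) * ?s (Vertex (tail ?G f)) \<approx>\<^bsub>?H\<^esub> 0"
        using lpa_vertices[OF tails, where 'k = 'k] orth by simp
      then show ?thesis
        using pres_rel_orthogonal[OF ghost_source[OF e] source[OF f]] orth by simp
    qed
  qed
  show "?s (Vertex v) \<approx>\<^bsub>?H\<^esub> (\<Sum>e\<in>out_arcs ?G v. ?s (Edge e) * ?s (Ghost e))"
    if v: "regular_vertex ?G v" for v
  proof (cases v)
    case (Inl u)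
    \<comment> \<open>An old vertex emits the same edges in both graphs, all fixed by the
      substitution, so CK2 carries over unchanged.\<close>
    have "regular_vertex ?H v"
      using v by (auto simp: Inl regular_vertex_def out_arcs_attach_Inl)
    from H.lpa_CK2[OF this, where 'k = 'k] show ?thesis
      by (simp add: Inl out_arcs_attach_Inl sum.reindex)
  next
    case (Inr i)
    then have i: "i \<in> {1..n}" using v by (auto simp: regular_vertex_def)
    then show ?thesis
      using pres_rel_sym[OF lpa_equivalentD(5)[OF FD[OF i]]]
      by (simp add: Inr out_arcs_attach_Inr chain_vertex_def)
  qed
qed


section \<open>The chain and the star\<close>

text \<open>The index 0 stands for the trivial path at \<open>v\<^sub>0\<close>.\<close>

definition spoke :: "'v \<Rightarrow> nat \<Rightarrow> ('v + nat, 'e + nat) lpa_gen fword \<Rightarrow>\<^sub>0 'k::field" where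
  "spoke v\<^sub>0 i = (if i = 0 then gen (Vertex (Inl v\<^sub>0)) else gen (Edge (Inr i)))"

definition spoke_ghost :: "'v \<Rightarrow> nat \<Rightarrow> ('v + nat, 'e + nat) lpa_gen fword \<Rightarrow>\<^sub>0 'k::field" where
  "spoke_ghost v\<^sub>0 i = (if i = 0 then gen (Vertex (Inl v\<^sub>0)) else gen (Ghost (Inr i)))"

text \<open>The path e_i ... e_1 with a trailing factor v_0; thus index 1 gives e_1 v_0, which is
  e_1 only modulo the relations.\<close>

fun chain_path :: "'v \<Rightarrow> nat \<Rightarrow> ('v + nat, 'e + nat) lpa_gen fword \<Rightarrow>\<^sub>0 'k::field" where
  "chain_path v\<^sub>0 0 = gen (Vertex (Inl v\<^sub>0))"
| "chain_path v\<^sub>0 (Suc i) = gen (Edge (Inr (Suc i))) * chain_path v\<^sub>0 i"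

fun chain_path_ghost :: "'v \<Rightarrow> nat \<Rightarrow> ('v + nat, 'e + nat) lpa_gen fword \<Rightarrow>\<^sub>0 'k::field" where
  "chain_path_ghost v\<^sub>0 0 = gen (Vertex (Inl v\<^sub>0))"
| "chain_path_ghost v\<^sub>0 (Suc i) = chain_path_ghost v\<^sub>0 i * gen (Ghost (Inr (Suc i)))"

text \<open>\<open>K\<close> only serves to fix the type \<open>'k\<close> throughout the context.\<close>

context
  fixes E :: "('v, 'e) pre_digraph" and v\<^sub>0 :: 'v and n :: nat and K :: "'k::field itself"
  assumes wf: "wf_digraph E" and v\<^sub>0: "v\<^sub>0 \<in> verts E"
begin

abbreviation (input) "chain \<equiv> attach E v\<^sub>0 n (\<lambda>i. chain_vertex v\<^sub>0 (i - 1))"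
abbreviation (input) "star \<equiv> attach E v\<^sub>0 n (\<lambda>i. chain_vertex v\<^sub>0 0)"

section \<open>Equivalences of v_i with v_0 in both graphs\<close>

lemma wf_chain: "wf_digraph chain"
  by (rule wf_digraph_attach[OF wf chain_vertex_in_attach[OF v\<^sub>0]]) auto

lemma wf_star: "wf_digraph star"
  by (rule wf_digraph_attach[OF wf chain_vertex_in_attach[OF v\<^sub>0]]) auto

text \<open>Admitting i = 0 lets e_1, whose range is v_0, be treated like the other chain
  edges.\<close>

lemma spoke_equivalent:
  assumes "i \<le> n"
  shows "lpa_equivalent star (chain_vertex v\<^sub>0 i) (chain_vertex v\<^sub>0 0) (spoke v\<^sub>0 i) (spoke_ghost v\<^sub>0 i)"
proof (cases "i = 0")
  case True
  then show ?thesis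
    using lpa_equivalent_refl[OF chain_vertex_in_attach[OF v\<^sub>0 assms]]
    by (simp add: spoke_def spoke_ghost_def chain_vertex_def)
next
  case False
  then show ?thesis
    using lpa_equivalent_attach[OF wf_star, of i] assms by (simp add: spoke_def spoke_ghost_def)
qed

text \<open>Each edge contributes an equivalence of v_i with its predecessor, and these compose down
  to v_0.\<close>

lemma chain_path_equivalent:
  assumes "i \<le> n"
  shows "lpa_equivalent chain (chain_vertex v\<^sub>0 i) (chain_vertex v\<^sub>0 0)
    (chain_path v\<^sub>0 i) (chain_path_ghost v\<^sub>0 i)"
  using assms
proof (induction i)
  case 0
  then show ?case
    using lpa_equivalent_refl[OF chain_vertex_in_attach[OF v\<^sub>0 0]] by (simp add: chain_vertex_def)
next
  case (Suc i)
  then show ?case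
    using lpa_equivalent_trans[OF lpa_equivalent_attach[OF wf_chain, of "Suc i"]] by simp
qed

text \<open>The edge from v_i to its predecessor is replaced by the route through v_0. At i = 1 the
  second factor is v_0 itself.\<close>

definition chain_to_star ::
    "('v + nat, 'e + nat) lpa_gen \<Rightarrow> ('v + nat, 'e + nat) lpa_gen fword \<Rightarrow>\<^sub>0 'k" where
  "chain_to_star =
    attach_subst (\<lambda>i. spoke v\<^sub>0 i * spoke_ghost v\<^sub>0 (i - 1))
      (\<lambda>i. spoke v\<^sub>0 (i - 1) * spoke_ghost v\<^sub>0 i)"

definition star_to_chain ::
    "('v + nat, 'e + nat) lpa_gen \<Rightarrow> ('v + nat, 'e + nat) lpa_gen fword \<Rightarrow>\<^sub>0 'k" where
  "star_to_chain = attach_subst (chain_path v\<^sub>0) (chain_path_ghost v\<^sub>0)"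

text \<open>An identity already in the free algebra, before any relation is used: at index 0 both
  elements are the fixed vertex v_0.\<close>

lemma star_to_chain_spoke: "free_subst star_to_chain (spoke v\<^sub>0 i) = chain_path v\<^sub>0 i"
  by (simp add: star_to_chain_def spoke_def)

lemma star_to_chain_spoke_ghost:
  "free_subst star_to_chain (spoke_ghost v\<^sub>0 i) = chain_path_ghost v\<^sub>0 i"
  by (simp add: star_to_chain_def spoke_ghost_def)

text \<open>The image telescopes: every inner f_i^* f_i equals v_0, which the factor before it
  absorbs.\<close>

lemma chain_to_star_chain_path:
  "i \<le> n \<Longrightarrow> free_subst chain_to_star (chain_path v\<^sub>0 i) \<approx>\<^bsub>star\<^esub> spoke v\<^sub>0 i"
proof (induction i)
  case 0
  then show ?case
    using v\<^sub>0 by (auto simp: chain_to_star_def spoke_def intro!: pres_rel_refl lpa_gens_in_free_alg)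
next
  case (Suc i)
  note S = lpa_equivalentD[OF spoke_equivalent[OF Suc.prems]]
    and I = lpa_equivalentD[OF spoke_equivalent[OF Suc_leD[OF Suc.prems]]]
  have "free_subst chain_to_star (chain_path v\<^sub>0 (Suc i)) =
      spoke v\<^sub>0 (Suc i) * (spoke_ghost v\<^sub>0 i * free_subst chain_to_star (chain_path v\<^sub>0 i))"
    by (simp add: free_subst_mult mult.assoc) (simp add: chain_to_star_def mult.assoc)
  also have "(\<dots>) \<approx>\<^bsub>star\<^esub>
      spoke v\<^sub>0 (Suc i) * (spoke_ghost v\<^sub>0 i * spoke v\<^sub>0 i)"
    using Suc by (intro pres_rel_mult_left S I) simp
  also have "spoke v\<^sub>0 (Suc i) * (spoke_ghost v\<^sub>0 i * spoke v\<^sub>0 i) \<approx>\<^bsub>star\<^esub>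
      spoke v\<^sub>0 (Suc i) * gen (Vertex (chain_vertex v\<^sub>0 0))"
    by (intro pres_rel_mult_left S I)
  also have "spoke v\<^sub>0 (Suc i) * gen (Vertex (chain_vertex v\<^sub>0 0)) \<approx>\<^bsub>star\<^esub>
      spoke v\<^sub>0 (Suc i)"
    by (rule S)
  finally show ?case .
qed

text \<open>The mirror image of the telescoping for paths, with v_0 absorbed by the ghost after
  it.\<close>

lemma chain_to_star_chain_path_ghost:
  "i \<le> n \<Longrightarrow> free_subst chain_to_star (chain_path_ghost v\<^sub>0 i) \<approx>\<^bsub>star\<^esub> spoke_ghost v\<^sub>0 i"
proof (induction i)
  case 0
  then show ?case
    using v\<^sub>0 by (auto simp: chain_to_star_def spoke_ghost_def intro!: pres_rel_refl lpa_gens_in_free_alg)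
next
  case (Suc i)
  note S = lpa_equivalentD[OF spoke_equivalent[OF Suc.prems]]
    and I = lpa_equivalentD[OF spoke_equivalent[OF Suc_leD[OF Suc.prems]]]
  have "free_subst chain_to_star (chain_path_ghost v\<^sub>0 (Suc i)) =
      free_subst chain_to_star (chain_path_ghost v\<^sub>0 i) * spoke v\<^sub>0 i * spoke_ghost v\<^sub>0 (Suc i)"
    by (simp add: free_subst_mult mult.assoc) (simp add: chain_to_star_def)
  also have "(\<dots>) \<approx>\<^bsub>star\<^esub>
      spoke_ghost v\<^sub>0 i * spoke v\<^sub>0 i * spoke_ghost v\<^sub>0 (Suc i)"
    using Suc by (intro pres_rel_mult_right S I) simp
  also have "spoke_ghost v\<^sub>0 i * spoke v\<^sub>0 i * spoke_ghost v\<^sub>0 (Suc i) \<approx>\<^bsub>star\<^esub>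
      gen (Vertex (chain_vertex v\<^sub>0 0)) * spoke_ghost v\<^sub>0 (Suc i)"
    by (intro pres_rel_mult_right S I)
  also have "gen (Vertex (chain_vertex v\<^sub>0 0)) * spoke_ghost v\<^sub>0 (Suc i) \<approx>\<^bsub>star\<^esub>
      spoke_ghost v\<^sub>0 (Suc i)"
    by (rule S)
  finally show ?case .
qed

text \<open>With p the path from the predecessor v_j of v_i down to v_0, the edge e_i goes to f_i
  f_j^* and back to e_i p p^*. Since p p^* = v_j is the range of e_i, only e_i remains.\<close>

lemma star_to_chain_edge:
  assumes "i \<in> {1..n}"
  shows "free_subst star_to_chain (chain_to_star (Edge (Inr i))) \<approx>\<^bsub>chain\<^esub> gen (Edge (Inr i))"
    and "free_subst star_to_chain (chain_to_star (Ghost (Inr i))) \<approx>\<^bsub>chain\<^esub> gen (Ghost (Inr i))"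
proof -
  obtain j where i: "i = Suc j" and j: "j \<le> n" using assms by (cases i) auto
  note P = lpa_equivalentD[OF chain_path_equivalent[OF j]]
    and e = lpa_equivalentD[OF lpa_equivalent_attach[OF wf_chain assms]]
  have "free_subst star_to_chain (chain_to_star (Edge (Inr i))) =
      gen (Edge (Inr i)) * (chain_path v\<^sub>0 j * chain_path_ghost v\<^sub>0 j)"
    by (simp add: chain_to_star_def free_subst_mult star_to_chain_spoke star_to_chain_spoke_ghost
        i mult.assoc)
  also have "(\<dots>) \<approx>\<^bsub>chain\<^esub>
      gen (Edge (Inr i)) * gen (Vertex (chain_vertex v\<^sub>0 j))"
    by (intro pres_rel_mult_left P e)
  also have "gen (Edge (Inr i)) * gen (Vertex (chain_vertex v\<^sub>0 j)) \<approx>\<^bsub>chain\<^esub>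
      gen (Edge (Inr i))"
    using e(2) by (simp add: i)
  finally show "free_subst star_to_chain (chain_to_star (Edge (Inr i))) \<approx>\<^bsub>chain\<^esub> gen (Edge (Inr i))" .
  have "free_subst star_to_chain (chain_to_star (Ghost (Inr i))) =
      chain_path v\<^sub>0 j * chain_path_ghost v\<^sub>0 j * gen (Ghost (Inr i))"
    by (simp add: chain_to_star_def free_subst_mult star_to_chain_spoke star_to_chain_spoke_ghost
        i mult.assoc)
  also have "(\<dots>) \<approx>\<^bsub>chain\<^esub>
      gen (Vertex (chain_vertex v\<^sub>0 j)) * gen (Ghost (Inr i))"
    by (intro pres_rel_mult_right P e)
  also have "gen (Vertex (chain_vertex v\<^sub>0 j)) * gen (Ghost (Inr i)) \<approx>\<^bsub>chain\<^esub>
      gen (Ghost (Inr i))"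
    using e(3) by (simp add: i)
  finally show "free_subst star_to_chain (chain_to_star (Ghost (Inr i))) \<approx>\<^bsub>chain\<^esub> gen (Ghost (Inr i))" .
qed

section \<open>The two homomorphisms are mutually inverse\<close>

lemma lpa_chain_isomorphic_star:
  "leavitt_path_algebra TYPE('k) chain \<cong>\<^sub>a leavitt_path_algebra TYPE('k) star"
  unfolding leavitt_path_algebra_def
proof (rule presented_alg_isomorphicI[where \<sigma> = chain_to_star and \<tau> = star_to_chain])
  \<comment> \<open>The equivalence of v_i with v_0 is followed by the reverse of the one for the
    preceding index.\<close>
  have F: "lpa_equivalent star (chain_vertex v\<^sub>0 i) (chain_vertex v\<^sub>0 (i - 1))
      (spoke v\<^sub>0 i * spoke_ghost v\<^sub>0 (i - 1)) (spoke v\<^sub>0 (i - 1) * spoke_ghost v\<^sub>0 i)"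
    if "i \<in> {1..n}" for i
    using that
    by (intro lpa_equivalent_trans[OF spoke_equivalent lpa_equivalent_sym[OF spoke_equivalent]]) auto
  have P: "lpa_equivalent chain (chain_vertex v\<^sub>0 i) (chain_vertex v\<^sub>0 0)
      (chain_path v\<^sub>0 i) (chain_path_ghost v\<^sub>0 i)" if "i \<in> {1..n}" for i
    using that by (intro chain_path_equivalent) auto
  show "chain_to_star x \<in> free_alg (lpa_gens star)" if "x \<in> lpa_gens chain" for x
    unfolding chain_to_star_def using F that by (rule attach_subst_in_free_alg)
  show "star_to_chain x \<in> free_alg (lpa_gens chain)" if "x \<in> lpa_gens star" for x
    unfolding star_to_chain_def using P that by (rule attach_subst_in_free_alg)
  show "free_subst chain_to_star r \<in> gen_ideal (lpa_gens star) (lpa_relators star)"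
    if "r \<in> lpa_relators chain" for r
    unfolding chain_to_star_def using wf_star F that by (rule attach_subst_relators)
  show "free_subst star_to_chain r \<in> gen_ideal (lpa_gens chain) (lpa_relators chain)"
    if "r \<in> lpa_relators star" for r
    unfolding star_to_chain_def using wf_chain P that by (rule attach_subst_relators)
  show "free_subst star_to_chain (chain_to_star x) \<approx>\<^bsub>chain\<^esub> gen x" if x: "x \<in> lpa_gens chain" for x
  proof -
    \<comment> \<open>Vertices, old edges and old ghosts are fixed by both maps, which leaves the
      new edges and their ghosts.\<close>
    consider "star_to_chain x = gen x" "chain_to_star x = gen x"
      | i where "i \<in> {1..n}" "x = Edge (Inr i)" | i where "i \<in> {1..n}" "x = Ghost (Inr i)"
      using x by (auto simp: lpa_gens_def chain_to_star_def star_to_chain_def)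
    then show ?thesis
    proof cases
      case 1
      then show ?thesis using x by (simp add: pres_rel_refl gen_in_free_alg)
    next
      case (2 i)
      then show ?thesis using star_to_chain_edge(1)[of i] by simp
    next
      case (3 i)
      then show ?thesis using star_to_chain_edge(2)[of i] by simp
    qed
  qed
  show "free_subst chain_to_star (star_to_chain x) \<approx>\<^bsub>star\<^esub> gen x" if x: "x \<in> lpa_gens star" for x
  proof -
    consider "star_to_chain x = gen x" "chain_to_star x = gen x"
      | i where "i \<in> {1..n}" "x = Edge (Inr i)" | i where "i \<in> {1..n}" "x = Ghost (Inr i)"
      using x by (auto simp: lpa_gens_def chain_to_star_def star_to_chain_def)
    then show ?thesis
    proof cases
      case 1
      then show ?thesis using x by (simp add: pres_rel_refl gen_in_free_alg)
    next
      case (2 i)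
      then show ?thesis
        using chain_to_star_chain_path[of i] by (simp add: star_to_chain_def spoke_def)
    next
      case (3 i)
      then show ?thesis
        using chain_to_star_chain_path_ghost[of i] by (simp add: star_to_chain_def spoke_ghost_def)
    qed
  qed
qed

end

theorem corollary3p9:
  fixes E :: "('v, 'e) pre_digraph" and v\<^sub>0 :: 'v and n :: nat
  assumes "wf_digraph E" and "row_finite E" and "v\<^sub>0 \<in> verts E" and "0 < n"
  shows "leavitt_path_algebra TYPE('k::field) (chain_graph E v\<^sub>0 n)
    \<cong>\<^sub>a leavitt_path_algebra TYPE('k) (star_graph E v\<^sub>0 n)"
  unfolding chain_graph_eq_attach star_graph_eq_attach
  using assms(1,3) by (rule lpa_chain_isomorphic_star)

end
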